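(* Let $D$ be a principal ideal domain and let $\alpha = \begin{pmatrix} a & b \\ 0 & a \end{pmatrix} \in R(D)$ be a nonzero nonunit such that $c \in \mathrm{GCD}(a,b)$, $a = ca_1$, and $b = cb_1$ for some $c, a_1, b_1 \in D$. Let $c = u p_1^{e_1}\cdots p_n^{e_n}$ and $a_1 = q_1^{k_1}\cdots q_m^{k_m}$ (when $a \neq 0$) be prime factorizations of $c$ and $a_1$, respectively, where $u \in U(D)$. The following is a factorization of $\alpha$ into irreducible elements. (1) If $a = 0$, then $\alpha = \begin{pmatrix} 0 & u \\ 0 & 0 \end{pmatrix} \prod_{i=1}^n \begin{pmatrix} p_i & 0 \\ 0 & p_i \end{pmatrix}^{e_i}$. (2) If $a \neq 0$, then $\alpha = \begin{pmatrix} u & 0 \\ 0 & u \end{pmatrix} \left(\prod_{i=1}^n \begin{pmatrix} p_i & 0 \\ 0 & p_i \end{pmatrix}^{e_i}\right)\left(\prod_{j=1}^m \begin{pmatrix} q_j^{k_j} & c_j \\ 0 & q_j^{k_j} \end{pmatrix}\right)$ for some $c_j \in D$ with $1 \in \mathrm{GCD}(c_j, q_j)$.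
   Context: For an integral domain $D$, $R(D) = \left\{\begin{pmatrix} a & b \\ 0 & a \end{pmatrix} : a,b \in D\right\}$, a commutative ring with identity under the usual matrix addition and multiplication. For a commutative ring $R$ with identity, $U(R)$ is its set of units. Two elements $a,b \in R$ are associates if $aR = bR$. An element $a \in R$ is irreducible if $a = bc$ implies that either $b$ or $c$ is associated with $a$. $\mathrm{GCD}(a,b)$ denotes the set of greatest common divisors of $a$ and $b$ in $D$. In the prime factorizations, the $p_i$ are pairwise non-associated prime elements of $D$, the $q_j$ are pairwise non-associated prime elements of $D$, and the exponents $e_i, k_j$ are positive integers.
   Formalization: In (1) the entry u is replaced by u·b_1, with b_1 shown to be a unit (the printed formula needs b_1 = 1); in (2) the printed formula is stated for m ≥ 1, and for m = 0 the unit factor has upper right entry u·b_1 instead of 0. *)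

theory Defs
  imports "HOL-Analysis.Cartesian_Space" "HOL-Algebra.Ring_Divisibility"
begin

definition utm :: "('a, 'b) ring_scheme \<Rightarrow> 'a \<Rightarrow> 'a \<Rightarrow> 'a^2^2" where
  "utm D a b = (\<chi> i j. if i = j then a else if i = 1 then b else \<zero>\<^bsub>D\<^esub>)"

text \<open>
  \<open>utm D a b\<close> is the matrix with both diagonal entries \<open>a\<close>, upper right entry \<open>b\<close> and lower left
  entry zero; the entry in row \<open>i\<close> and column \<open>j\<close> of \<open>A\<close> is \<open>A $ i $ j\<close>.  The operations below are
  the usual ones for two by two matrices, written with the operations of the structure \<open>D\<close>
  (the library's matrix product would use type class arithmetic on \<open>'a\<close> instead).
\<close>

definition utm_ring :: "('a, 'b) ring_scheme \<Rightarrow> ('a^2^2) ring" where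
  "utm_ring D =
    \<lparr> carrier = {utm D a b | a b. a \<in> carrier D \<and> b \<in> carrier D},
      mult = (\<lambda>A B. \<chi> i j. A $ i $ 1 \<otimes>\<^bsub>D\<^esub> B $ 1 $ j \<oplus>\<^bsub>D\<^esub> A $ i $ 2 \<otimes>\<^bsub>D\<^esub> B $ 2 $ j),
      one = (\<chi> i j. if i = j then \<one>\<^bsub>D\<^esub> else \<zero>\<^bsub>D\<^esub>),
      zero = (\<chi> i j. \<zero>\<^bsub>D\<^esub>),
      add = (\<lambda>A B. \<chi> i j. A $ i $ j \<oplus>\<^bsub>D\<^esub> B $ i $ j) \<rparr>"

definition associates :: "('a, 'b) ring_scheme \<Rightarrow> 'a \<Rightarrow> 'a \<Rightarrow> bool" where
  "associates R a b \<longleftrightarrow> PIdl\<^bsub>R\<^esub> a = PIdl\<^bsub>R\<^esub> b"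

text \<open>
  In a ring with zero divisors this is weaker than the requirement that one of the two factors be
  a unit.  Units satisfy it trivially, so being a nonunit has to be asked for separately.
\<close>

definition irreducible_elt :: "('a, 'b) ring_scheme \<Rightarrow> 'a \<Rightarrow> bool" where
  "irreducible_elt R a \<longleftrightarrow> a \<in> carrier R \<and>
    (\<forall>b \<in> carrier R. \<forall>c \<in> carrier R. a = b \<otimes>\<^bsub>R\<^esub> c \<longrightarrow> associates R b a \<or> associates R c a)"

lemma two_neq [simp]: "(1::2) \<noteq> 2" "(2::2) \<noteq> 1"
  by simp_all

lemma utm_eqI:
  fixes A B :: "'a^2^2"
  assumes "A $ 1 $ 1 = B $ 1 $ 1" "A $ 1 $ 2 = B $ 1 $ 2"
    and "A $ 2 $ 1 = B $ 2 $ 1" "A $ 2 $ 2 = B $ 2 $ 2"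
  shows "A = B"
proof -
  have "A $ i $ j = B $ i $ j" for i j
    using assms exhaust_2[of i] exhaust_2[of j] by auto
  then show ?thesis by (simp add: vec_eq_iff)
qed

lemma utm_nth [simp]:
  "utm D a b $ 1 $ 1 = a" "utm D a b $ 1 $ 2 = b"
  "utm D a b $ 2 $ 1 = \<zero>\<^bsub>D\<^esub>" "utm D a b $ 2 $ 2 = a"
  unfolding utm_def by simp_all

lemma utm_eq_iff: "utm D a b = utm D a' b' \<longleftrightarrow> a = a' \<and> b = b'"
  by (metis utm_nth(1,2))

lemma utm_carrier_iff:
  "utm D a b \<in> carrier (utm_ring D) \<longleftrightarrow> a \<in> carrier D \<and> b \<in> carrier D"
  by (auto simp: utm_ring_def utm_eq_iff)

lemma utm_one: "\<one>\<^bsub>utm_ring D\<^esub> = utm D \<one>\<^bsub>D\<^esub> \<zero>\<^bsub>D\<^esub>"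
  and utm_zero: "\<zero>\<^bsub>utm_ring D\<^esub> = utm D \<zero>\<^bsub>D\<^esub> \<zero>\<^bsub>D\<^esub>"
  by (rule utm_eqI; simp add: utm_ring_def)+

lemma (in cring) utm_mult:
  assumes "a \<in> carrier R" "b \<in> carrier R" "a' \<in> carrier R" "b' \<in> carrier R"
  shows "utm R a b \<otimes>\<^bsub>utm_ring R\<^esub> utm R a' b' = utm R (a \<otimes> a') (a \<otimes> b' \<oplus> b \<otimes> a')"
  by (rule utm_eqI) (use assms in \<open>simp_all add: utm_ring_def\<close>)

lemma (in cring) utm_add:
  assumes "a \<in> carrier R" "b \<in> carrier R" "a' \<in> carrier R" "b' \<in> carrier R"
  shows "utm R a b \<oplus>\<^bsub>utm_ring R\<^esub> utm R a' b' = utm R (a \<oplus> a') (b \<oplus> b')"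
  by (rule utm_eqI) (use assms in \<open>simp_all add: utm_ring_def\<close>)

lemma (in cring) utm_ring_cring: "cring (utm_ring R)"
proof -
  have ex: "\<exists>a\<in>carrier R. \<exists>b\<in>carrier R. x = utm R a b" if "x \<in> carrier (utm_ring R)" for x
    using that by (auto simp: utm_ring_def)
  note s = utm_mult utm_add utm_one utm_zero utm_carrier_iff utm_eq_iff
  show ?thesis
  proof (rule cringI)
    show "abelian_group (utm_ring R)"
    proof (rule abelian_groupI)
      fix x assume "x \<in> carrier (utm_ring R)"
      then obtain a b where x: "a \<in> carrier R" "b \<in> carrier R" "x = utm R a b" using ex by blast
      then show "\<exists>y\<in>carrier (utm_ring R). y \<oplus>\<^bsub>utm_ring R\<^esub> x = \<zero>\<^bsub>utm_ring R\<^esub>"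
        by (intro bexI[of _ "utm R (\<ominus> a) (\<ominus> b)"]) (auto simp: s l_neg)
    qed (auto dest!: ex simp: s a_ac)
    show "comm_monoid (utm_ring R)"
    proof (rule comm_monoidI)
    qed (auto dest!: ex simp: s m_ac a_ac l_distr r_distr)
  qed (auto dest!: ex simp: s m_ac a_ac l_distr r_distr)
qed

end

theory Submission
  imports Defs
begin

text \<open>
  Write \<open>(a, b)\<close> for \<open>utm D a b\<close>; the product is \<open>(a, b) (a', b') = (a a', a b' + b a')\<close>, so
  \<open>R(D)\<close> is \<open>D[t]/(t\<^sup>2)\<close> and \<open>(a, b)\<close> stands for \<open>a + b t\<close>.  An element is a unit exactly when its
  diagonal entry is a unit of \<open>D\<close> (lemma \<open>utm_Units_iff\<close>), hence questions about factorizations in \<open>R(D)\<close>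
  are largely questions about factorizations of the diagonal entry in \<open>D\<close>.

  Each of the three kinds of factors is irreducible because one of the factors in any of its
  factorizations is a unit.  For \<open>(p, 0)\<close> this is the irreducibility of \<open>p\<close>.  If \<open>(0, v)\<close> with
  \<open>v\<close> a unit is a product, one of the diagonal entries is zero, and then the other one divides \<open>v\<close>.
  If \<open>(q\<^sup>k, d) = (x, y) (x', y')\<close> with nonunits \<open>x\<close> and \<open>x'\<close>, then \<open>q\<close> divides both of them, so it
  divides \<open>d = x y' + y x'\<close>; this is excluded when \<open>d\<close> is prime to \<open>q\<close>.

  It remains to factor \<open>(a\<^sub>1, b\<^sub>1)\<close>, which is what taking \<open>c\<close> out of \<open>\<alpha>\<close> leaves.  Since \<open>c\<close> is a
  greatest common divisor, \<open>a\<^sub>1\<close> and \<open>b\<^sub>1\<close> have no common divisors but units.  If \<open>a = 0\<close>, then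
  \<open>a\<^sub>1 = 0\<close>, so \<open>b\<^sub>1\<close> itself is a unit and \<open>(0, b\<^sub>1)\<close> is irreducible; if \<open>a\<^sub>1 = 1\<close>, then \<open>(a\<^sub>1, b\<^sub>1)\<close>
  is a unit.  In the remaining case no \<open>q\<^sub>j\<close> divides \<open>b\<^sub>1\<close>.  The product of the \<open>(q\<^sub>j\<^sup>k\<^sup>j, d\<^sub>j)\<close> has
  off-diagonal entry \<open>\<Sum>\<^sub>j d\<^sub>j \<Prod>\<^sub>i\<^sub>\<noteq>\<^sub>j q\<^sub>i\<^sup>k\<^sup>i\<close>, so the task is a partial fraction decomposition of
  \<open>b\<^sub>1 / a\<^sub>1\<close>.  Lemma \<open>prime_power_splitting\<close> obtains it by splitting off one prime power at a time
  with Bezout's identity; that \<open>q\<^sub>j\<close> does not divide \<open>d\<^sub>j\<close> comes for free, because every other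
  summand of \<open>b\<^sub>1\<close> is divisible by \<open>q\<^sub>j\<close>.
\<close>

section \<open>Divisibility by primes in a domain\<close>

lemma (in cring) divides_add:
  assumes "a \<in> carrier R" "b \<in> carrier R" "c \<in> carrier R" "a divides b" "a divides c"
  shows "a divides (b \<oplus> c)"
proof -
  obtain s t where "s \<in> carrier R" "b = a \<otimes> s" "t \<in> carrier R" "c = a \<otimes> t"
    using assms(4,5) unfolding factor_def by blast
  then have "b \<oplus> c = a \<otimes> (s \<oplus> t)" "s \<oplus> t \<in> carrier R"
    using assms by (simp_all add: r_distr)
  then show ?thesis unfolding factor_def by blast
qed

lemma (in cring) finprod_dvd:
  assumes "finite J" "f \<in> J \<rightarrow> carrier R" "j \<in> J"
  shows "f j divides finprod R f J"
proof -
  have "finprod R f (insert j (J - {j})) = f j \<otimes> finprod R f (J - {j})"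
    using assms by (intro finprod_insert) auto
  moreover have "finprod R f (J - {j}) \<in> carrier R"
    using assms(2) by (intro finprod_closed) auto
  ultimately show ?thesis using assms(3) unfolding factor_def by (auto simp: insert_absorb)
qed

lemma (in cring) divides_mult_left:
  assumes "a \<in> carrier R" "b \<in> carrier R" "c \<in> carrier R" "a divides c"
  shows "a divides b \<otimes> c"
  using assms divides_prod_l by blast

lemma (in cring) divides_mult_right:
  assumes "a \<in> carrier R" "b \<in> carrier R" "c \<in> carrier R" "a divides b"
  shows "a divides b \<otimes> c"
  using assms divides_prod_r by blast

lemma (in cring) divides_pow:
  assumes "a \<in> carrier R" "0 < (k::nat)"
  shows "a divides a [^] k"
proof -
  obtain l where "k = Suc l" using assms(2) gr0_conv_Suc by blast
  then show ?thesis using assms(1) by (simp add: divides_mult_left)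
qed

lemma (in domain) ring_prime_dvd_mult:
  assumes "q \<in> carrier R" "ring_prime q" "x \<in> carrier R" "y \<in> carrier R" "q divides x \<otimes> y"
  shows "q divides x \<or> q divides y"
  using ring_primeE(3)[OF assms(1,2)] assms(3-5) unfolding Divisibility.prime_def by blast

lemma (in domain) ring_prime_not_unit:
  assumes "q \<in> carrier R" "ring_prime q"
  shows "q \<notin> Units R"
  using ring_primeE(3)[OF assms] unfolding Divisibility.prime_def by blast

lemma (in domain) ring_prime_not_dvd_one:
  assumes "q \<in> carrier R" "ring_prime q"
  shows "\<not> q divides \<one>"
  using ring_prime_not_unit[OF assms] divides_one[OF assms(1)] by blast

lemma (in domain) ring_prime_dvd_pow:
  assumes "q \<in> carrier R" "ring_prime q" "x \<in> carrier R" "q divides x [^] (k::nat)"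
  shows "q divides x"
  using assms(4)
proof (induction k)
  case 0
  then show ?case using ring_prime_not_dvd_one[OF assms(1,2)] by simp
next
  case (Suc k)
  then have "q divides x [^] k \<otimes> x" by simp
  then show ?case using ring_prime_dvd_mult[OF assms(1,2)] assms(3) Suc.IH by blast
qed

lemma (in domain) ring_prime_dvd_finprod:
  assumes "finite J" "q \<in> carrier R" "ring_prime q" "f \<in> J \<rightarrow> carrier R"
    and "q divides finprod R f J"
  shows "\<exists>j\<in>J. q divides f j"
  using assms(1,4,5)
proof (induction J rule: finite_induct)
  case empty
  then show ?case using ring_prime_not_dvd_one[OF assms(2,3)] by simp
next
  case (insert j J)
  then have "q divides f j \<otimes> finprod R f J" "f j \<in> carrier R" "f \<in> J \<rightarrow> carrier R" by auto
  then have "q divides f j \<or> q divides finprod R f J"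
    using ring_prime_dvd_mult[OF assms(2,3)] finprod_closed by blast
  then show ?case using insert.IH[OF \<open>f \<in> J \<rightarrow> carrier R\<close>] by blast
qed

lemma (in domain) ring_prime_factor:
  assumes "p \<in> carrier R" "ring_prime p" "x \<in> carrier R" "y \<in> carrier R" "p = x \<otimes> y"
  shows "x \<in> Units R \<or> y \<in> Units R"
proof -
  have cancel: "v \<in> Units R"
    if "u \<in> carrier R" "v \<in> carrier R" "p = u \<otimes> v" "p divides u" for u v
  proof -
    obtain w where w: "w \<in> carrier R" "u = p \<otimes> w"
      using \<open>p divides u\<close> unfolding factor_def by blast
    have "p \<otimes> (w \<otimes> v) = (p \<otimes> w) \<otimes> v" using that(2) w(1) assms(1) m_assoc by simp
    also have "\<dots> = p \<otimes> \<one>" unfolding w(2)[symmetric] that(3)[symmetric] using assms(1) by simp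
    finally have "p \<otimes> (w \<otimes> v) = p \<otimes> \<one>" .
    then have "w \<otimes> v = \<one>"
      using m_lcancel[OF ring_primeE(1)[OF assms(1,2)] assms(1)] w that by blast
    then show ?thesis using w that m_comm unfolding Units_def by force
  qed
  have "p divides x \<otimes> y" using assms(1,5) divides_refl by simp
  then have "p divides x \<or> p divides y" by (rule ring_prime_dvd_mult[OF assms(1-4)])
  moreover have "p = y \<otimes> x" using assms(3-5) m_comm by simp
  ultimately show ?thesis
    using cancel[OF assms(3,4,5)] cancel[OF assms(4,3)] by blast
qed

lemma (in domain) ring_prime_dvd_prime_imp_associates:
  assumes "p \<in> carrier R" "ring_prime p" "q \<in> carrier R" "ring_prime q" "q divides p"
  shows "associates R q p"
proof -
  obtain z where z: "z \<in> carrier R" "p = q \<otimes> z" using assms(5) unfolding factor_def by blast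
  then have "z \<in> Units R"
    using ring_prime_factor[OF assms(1,2,3)] ring_prime_not_unit[OF assms(3,4)] by blast
  then have "q \<sim> p" using z assms by (intro associated_sym[OF associatedI2]) auto
  then show ?thesis
    unfolding associates_def using associated_iff_same_ideal assms by blast
qed

text \<open>
  If \<open>q\<close> does not divide \<open>x\<close>, the whole power must sit in the cofactor: the powers of \<open>q\<close> can be
  cancelled one by one, until \<open>x\<close> is seen to divide \<open>1\<close>.
\<close>
lemma (in domain) prime_power_factor:
  assumes "q \<in> carrier R" "ring_prime q" "x \<in> carrier R" "x divides q [^] (k::nat)"
  shows "x \<in> Units R \<or> q divides x"
  using assms(4)
proof (induction k)
  case 0
  then show ?case using divides_one[OF assms(3)] by simp
next
  case (Suc k)
  then obtain y where y: "y \<in> carrier R" "q [^] Suc k = x \<otimes> y" unfolding factor_def by blast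
  have "q [^] Suc k = q \<otimes> q [^] k" using assms(1) by (simp add: m_comm)
  then have eq: "x \<otimes> y = q \<otimes> q [^] k" using y by simp
  then have "q divides x \<otimes> y" using assms(1) unfolding factor_def by auto
  then consider "q divides x" | "q divides y"
    using ring_prime_dvd_mult[OF assms(1-3) y(1)] by blast
  then show ?case
  proof cases
    case 2
    then obtain z where z: "z \<in> carrier R" "y = q \<otimes> z" unfolding factor_def by blast
    have "q \<otimes> (x \<otimes> z) = q \<otimes> q [^] k" using eq z assms by (simp add: m_lcomm)
    then have "x \<otimes> z = q [^] k"
      using m_lcancel[OF ring_primeE(1)[OF assms(1,2)] assms(1)] z assms by simp
    then have "x divides q [^] k" using z(1) unfolding factor_def by (intro bexI[of _ z]) auto
    then show ?thesis by (rule Suc.IH)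
  qed simp
qed

lemma (in domain) one_gcdof_prime:
  assumes "q \<in> carrier R" "ring_prime q" "d \<in> carrier R" "\<not> q divides d"
  shows "\<one> gcdof d q"
  unfolding isgcd_def
proof (intro conjI ballI impI)
  fix y assume y: "y \<in> carrier R" "y divides d \<and> y divides q"
  then have "y divides q [^] (1::nat)" using assms by simp
  then have "y \<in> Units R \<or> q divides y" using prime_power_factor[OF assms(1,2) y(1)] by blast
  then have "y \<in> Units R" using y assms divides_trans by blast
  then show "y divides \<one>" using divides_one y by blast
qed (use assms one_divides in auto)

section \<open>Units and irreducible elements of the matrix ring\<close>

lemma utm_carrierE:
  assumes "X \<in> carrier (utm_ring D)"
  obtains a b where "a \<in> carrier D" "b \<in> carrier D" "X = utm D a b"
  using assms unfolding utm_ring_def by auto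

text \<open>
  The converse direction rests on \<open>(a, b) (a\<^sup>-\<^sup>1, - a\<^sup>-\<^sup>1 b a\<^sup>-\<^sup>1) = (1, 0)\<close>.
\<close>
lemma (in cring) utm_Units_iff:
  assumes "a \<in> carrier R" "b \<in> carrier R"
  shows "utm R a b \<in> Units (utm_ring R) \<longleftrightarrow> a \<in> Units R"
proof
  assume "utm R a b \<in> Units (utm_ring R)"
  then obtain Y where "Y \<in> carrier (utm_ring R)"
    and Y: "utm R a b \<otimes>\<^bsub>utm_ring R\<^esub> Y = \<one>\<^bsub>utm_ring R\<^esub>"
    unfolding Units_def by blast
  then obtain x y where "x \<in> carrier R" "y \<in> carrier R" "Y = utm R x y"
    by (elim utm_carrierE)
  then have "x \<in> carrier R" "a \<otimes> x = \<one>"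
    using Y assms by (simp_all add: utm_mult utm_one utm_eq_iff)
  then show "a \<in> Units R" using assms m_comm unfolding Units_def by force
next
  interpret M: cring "utm_ring R" by (rule utm_ring_cring)
  assume a: "a \<in> Units R"
  let ?y = "\<ominus> (inv a \<otimes> (b \<otimes> inv a))"
  have c: "inv a \<in> carrier R" using a by simp
  have "a \<otimes> ?y = \<ominus> ((a \<otimes> inv a) \<otimes> (b \<otimes> inv a))"
    using assms c by (simp add: r_minus m_assoc)
  also have "\<dots> = \<ominus> (b \<otimes> inv a)" using a assms c by simp
  finally have "a \<otimes> ?y \<oplus> b \<otimes> inv a = \<zero>" using assms c by (simp add: l_neg)
  then have "utm R a b \<otimes>\<^bsub>utm_ring R\<^esub> utm R (inv a) ?y = \<one>\<^bsub>utm_ring R\<^esub>"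
    using a assms c by (simp add: utm_mult utm_one)
  moreover have "utm R (inv a) ?y \<in> carrier (utm_ring R)" "utm R a b \<in> carrier (utm_ring R)"
    using assms c by (simp_all add: utm_carrier_iff)
  ultimately show "utm R a b \<in> Units (utm_ring R)"
    using M.m_comm unfolding Units_def by force
qed

lemma (in cring) irreducible_eltI:
  assumes "a \<in> carrier R"
    and "\<And>b c. \<lbrakk>b \<in> carrier R; c \<in> carrier R; a = b \<otimes> c\<rbrakk> \<Longrightarrow> b \<in> Units R \<or> c \<in> Units R"
  shows "irreducible_elt R a"
proof -
  have assoc: "associates R b a" if "b \<in> carrier R" "c \<in> Units R" "a = b \<otimes> c" for b c
  proof -
    have "b \<sim> a" using that by (intro associated_sym[OF associatedI2])
    then show ?thesis
      unfolding associates_def using associated_iff_same_ideal that assms(1) by blast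
  qed
  show ?thesis
    unfolding irreducible_elt_def using assms assoc m_comm by metis
qed

lemma (in cring) utm_irreducible_eltI:
  assumes "a \<in> carrier R" "b \<in> carrier R"
    and "\<And>x y x' y'. \<lbrakk>x \<in> carrier R; y \<in> carrier R; x' \<in> carrier R; y' \<in> carrier R;
           a = x \<otimes> x'; b = x \<otimes> y' \<oplus> y \<otimes> x'\<rbrakk> \<Longrightarrow> x \<in> Units R \<or> x' \<in> Units R"
  shows "irreducible_elt (utm_ring R) (utm R a b)"
proof (rule cring.irreducible_eltI[OF utm_ring_cring])
  show "utm R a b \<in> carrier (utm_ring R)" using assms(1,2) by (simp add: utm_carrier_iff)
next
  fix B C
  assume "B \<in> carrier (utm_ring R)" "C \<in> carrier (utm_ring R)"
    and BC: "utm R a b = B \<otimes>\<^bsub>utm_ring R\<^esub> C"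
  then obtain x y x' y' where
    *: "x \<in> carrier R" "y \<in> carrier R" "B = utm R x y"
       "x' \<in> carrier R" "y' \<in> carrier R" "C = utm R x' y'"
    by (elim utm_carrierE)
  then have "a = x \<otimes> x'" "b = x \<otimes> y' \<oplus> y \<otimes> x'"
    using BC by (simp_all add: utm_mult utm_eq_iff)
  then show "B \<in> Units (utm_ring R) \<or> C \<in> Units (utm_ring R)"
    using assms(3) * by (simp add: utm_Units_iff)
qed

lemma (in domain) utm_prime_irreducible:
  assumes "p \<in> carrier R" "ring_prime p" "b \<in> carrier R"
  shows "irreducible_elt (utm_ring R) (utm R p b)"
  using assms ring_prime_factor by (intro utm_irreducible_eltI) auto

lemma (in domain) utm_nilpotent_irreducible:
  assumes "v \<in> Units R"
  shows "irreducible_elt (utm_ring R) (utm R \<zero> v)"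
proof (rule utm_irreducible_eltI)
  fix x y x' y'
  assume *: "x \<in> carrier R" "y \<in> carrier R" "x' \<in> carrier R" "y' \<in> carrier R"
    "\<zero> = x \<otimes> x'" "v = x \<otimes> y' \<oplus> y \<otimes> x'"
  then consider "x = \<zero>" | "x' = \<zero>" using integral by metis
  then show "x \<in> Units R \<or> x' \<in> Units R"
  proof cases
    case 1
    then have "v = x' \<otimes> y" using *(2,3,4,6) m_comm by simp
    then have "x' \<otimes> y \<in> Units R" using assms by simp
    then show ?thesis using * unit_factor by blast
  next
    case 2
    then have "x \<otimes> y' \<in> Units R" using *(1,2,4,6) assms by simp
    then show ?thesis using * unit_factor by blast
  qed
qed (use assms in auto)

lemma (in domain) utm_prime_power_irreducible:
  assumes "q \<in> carrier R" "ring_prime q" "d \<in> carrier R" "\<not> q divides d"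
  shows "irreducible_elt (utm_ring R) (utm R (q [^] (k::nat)) d)"
proof (rule utm_irreducible_eltI)
  fix x y x' y'
  assume *: "x \<in> carrier R" "y \<in> carrier R" "x' \<in> carrier R" "y' \<in> carrier R"
    "q [^] k = x \<otimes> x'" "d = x \<otimes> y' \<oplus> y \<otimes> x'"
  have "q [^] k = x' \<otimes> x" using m_comm[OF *(1,3)] *(5) by simp
  then have "x' divides q [^] k" using *(1) unfolding factor_def by blast
  moreover have "x divides q [^] k" using *(3,5) unfolding factor_def by blast
  moreover have "\<not> (q divides x \<and> q divides x')"
  proof
    assume "q divides x \<and> q divides x'"
    then have "q divides d"
      unfolding *(6) using *(1-4) assms(1)
      by (intro divides_add divides_mult_left[of q y x'] divides_mult_right[of q x y']) auto
    then show False using assms(4) by blast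
  qed
  ultimately show "x \<in> Units R \<or> x' \<in> Units R"
    using prime_power_factor[OF assms(1,2)] *(1,3) by blast
qed (use assms in auto)

section \<open>Products in the matrix ring\<close>

lemma (in cring) utm_diag_pow:
  assumes "a \<in> carrier R"
  shows "utm R a \<zero> [^]\<^bsub>utm_ring R\<^esub> (k::nat) = utm R (a [^] k) \<zero>"
proof -
  interpret M: cring "utm_ring R" by (rule utm_ring_cring)
  show ?thesis by (induction k) (use assms in \<open>simp_all add: utm_one utm_mult\<close>)
qed

lemma (in cring) utm_diag_finprod:
  assumes "finite I" "f \<in> I \<rightarrow> carrier R"
  shows "(\<Otimes>\<^bsub>utm_ring R\<^esub>i\<in>I. utm R (f i) \<zero>) = utm R (finprod R f I) \<zero>"
proof -
  interpret M: cring "utm_ring R" by (rule utm_ring_cring)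
  show ?thesis
    using assms
    by (induction I rule: finite_induct)
      (simp_all add: utm_one utm_mult utm_carrier_iff Pi_iff)
qed

lemma (in cring) utm_diag_finprod_pow:
  assumes "finite I" "p \<in> I \<rightarrow> carrier R"
  shows "(\<Otimes>\<^bsub>utm_ring R\<^esub>i\<in>I. utm R (p i) \<zero> [^]\<^bsub>utm_ring R\<^esub> (e i :: nat))
    = utm R (\<Otimes>i\<in>I. p i [^] e i) \<zero>"
proof -
  interpret M: cring "utm_ring R" by (rule utm_ring_cring)
  have "(\<Otimes>\<^bsub>utm_ring R\<^esub>i\<in>I. utm R (p i) \<zero> [^]\<^bsub>utm_ring R\<^esub> e i)
    = (\<Otimes>\<^bsub>utm_ring R\<^esub>i\<in>I. utm R (p i [^] e i) \<zero>)"
    using assms(2) by (intro M.finprod_cong') (auto simp: Pi_iff utm_diag_pow utm_carrier_iff)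
  also have "\<dots> = utm R (\<Otimes>i\<in>I. p i [^] e i) \<zero>"
    using assms by (intro utm_diag_finprod) auto
  finally show ?thesis .
qed

section \<open>Splitting off prime powers\<close>

text \<open>
  The generator of the ideal generated by \<open>q\<^sup>k\<close> and \<open>r\<close> divides both; a nonunit divisor of \<open>q\<^sup>k\<close>
  is a multiple of \<open>q\<close> and cannot divide \<open>r\<close>, so the generator is a unit and the ideal is everything.
\<close>
lemma (in principal_domain) prime_power_bezout:
  assumes "q \<in> carrier R" "ring_prime q" "r \<in> carrier R" "\<not> q divides r" "b \<in> carrier R"
  obtains x y where "x \<in> carrier R" "y \<in> carrier R" "b = r \<otimes> y \<oplus> x \<otimes> q [^] (k::nat)"
proof -
  let ?Q = "q [^] k"
  have Q: "?Q \<in> carrier R" using assms by simp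
  let ?I = "PIdl r <+>\<^bsub>R\<^esub> PIdl ?Q"
  have I: "ideal ?I R" using add_ideals cgenideal_ideal assms(3) Q by blast
  then obtain g where g: "g \<in> carrier R" "?I = PIdl g" using exists_gen by blast
  have I_iff: "z \<in> ?I \<longleftrightarrow> (\<exists>y\<in>carrier R. \<exists>x\<in>carrier R. z = y \<otimes> r \<oplus> x \<otimes> ?Q)" for z
    unfolding set_add_def' cgenideal_def by blast
  have dvd: "g divides z" if "z \<in> ?I" for z
  proof -
    have "z \<in> PIdl g" using \<open>z \<in> ?I\<close> g(2) by simp
    then obtain w where w: "w \<in> carrier R" "z = w \<otimes> g" unfolding cgenideal_def by blast
    then have "z = g \<otimes> w" using m_comm[OF w(1) g(1)] by simp
    then show ?thesis using w(1) unfolding factor_def by blast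
  qed
  have "r \<in> ?I" unfolding I_iff
    by (rule bexI[of _ \<one>], rule bexI[of _ \<zero>]) (use assms(3) Q in simp_all)
  moreover have "?Q \<in> ?I" unfolding I_iff
    by (rule bexI[of _ \<zero>], rule bexI[of _ \<one>]) (use assms(3) Q in simp_all)
  ultimately have "g divides r" "g divides ?Q" using dvd by blast+
  moreover have "\<not> q divides g"
    using divides_trans[of q g r] \<open>g divides r\<close> assms(1,4) by blast
  ultimately have "g \<in> Units R" using prime_power_factor[OF assms(1,2) g(1)] by blast
  then have "b \<in> ?I" using ideal_eq_carrier_iff[OF g(1)] g(2) assms(5) by simp
  then obtain x y where "x \<in> carrier R" "y \<in> carrier R" "b = y \<otimes> r \<oplus> x \<otimes> ?Q"
    unfolding I_iff by blast
  then show ?thesis using that[of x y] m_comm[of y r] assms(3) by simp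
qed

text \<open>
  Let \<open>r\<close> be the product of the prime powers other than \<open>q\<^sub>s\<^sup>k\<close>.  Bezout gives \<open>b = r y + x q\<^sub>s\<^sup>k\<close>,
  that is, \<open>(r q\<^sub>s\<^sup>k, b) = (q\<^sub>s\<^sup>k, y) (r, x)\<close>.  A prime dividing both \<open>x\<close> and \<open>r\<close> would divide \<open>b\<close>, so
  the induction hypothesis splits \<open>(r, x)\<close> further.  The index set has to be nonempty: the empty
  product \<open>(1, 0)\<close> accounts for no off-diagonal entry but zero.
\<close>
lemma (in principal_domain) prime_power_splitting:
  fixes k :: "'c \<Rightarrow> nat"
  assumes "finite J" "J \<noteq> {}"
    and "\<And>j. j \<in> J \<Longrightarrow> q j \<in> carrier R \<and> ring_prime (q j) \<and> 0 < k j"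
    and "\<And>i j. \<lbrakk>i \<in> J; j \<in> J; i \<noteq> j\<rbrakk> \<Longrightarrow> \<not> associates R (q i) (q j)"
    and "b \<in> carrier R" "\<And>j. j \<in> J \<Longrightarrow> \<not> q j divides b"
  shows "\<exists>d. (\<forall>j\<in>J. d j \<in> carrier R \<and> \<not> q j divides d j)
    \<and> (\<Otimes>\<^bsub>utm_ring R\<^esub>j\<in>J. utm R (q j [^] k j) (d j))
        = utm R (\<Otimes>j\<in>J. q j [^] k j) b"
  using assms
proof (induction J arbitrary: b rule: finite_ne_induct)
  case (singleton j)
  interpret M: cring "utm_ring R" by (rule utm_ring_cring)
  show ?case
    by (rule exI[of _ "\<lambda>_. b"]) (use singleton in \<open>simp add: utm_carrier_iff\<close>)
next
  case (insert s J)
  interpret M: cring "utm_ring R" by (rule utm_ring_cring)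
  let ?r = "\<Otimes>j\<in>J. q j [^] k j" and ?Q = "q s [^] k s"
  have q: "q j \<in> carrier R" "ring_prime (q j)" if "j \<in> insert s J" for j
    using insert.prems(1) that by blast+
  have Q: "?Q \<in> carrier R" and pow: "(\<lambda>j. q j [^] k j) \<in> J \<rightarrow> carrier R" using q by auto
  then have r: "?r \<in> carrier R" by simp
  have not_dvd: "\<not> q i divides q j" if "i \<in> insert s J" "j \<in> insert s J" "i \<noteq> j" for i j
    using ring_prime_dvd_prime_imp_associates[OF q[OF that(2)] q[OF that(1)]]
      insert.prems(2)[OF that] by blast
  have "\<not> q s divides ?r"
  proof
    assume "q s divides ?r"
    then obtain j where j: "j \<in> J" "q s divides q j [^] k j"
      using ring_prime_dvd_finprod[OF insert.hyps(1) q pow, of s] by blast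
    then have "q s divides q j" using ring_prime_dvd_pow[of "q s" "q j" "k j"] q by simp
    then show False using not_dvd[of s j] j(1) insert.hyps(3) by auto
  qed
  then obtain x y where xy: "x \<in> carrier R" "y \<in> carrier R" "b = ?r \<otimes> y \<oplus> x \<otimes> ?Q"
    using prime_power_bezout[of "q s" ?r b "k s" thesis] q[of s] r insert.prems(3) by simp
  have q_pow: "q j divides q j [^] k j" if "j \<in> insert s J" for j
    using insert.prems(1)[OF that] by (intro divides_pow) auto
  have not_dvd_y: "\<not> q s divides y"
  proof
    assume "q s divides y"
    then have "q s divides b"
      unfolding xy(3) using q[of s] r Q xy(1,2) q_pow[of s]
      by (intro divides_add divides_mult_left) auto
    then show False using insert.prems(4) by blast
  qed
  have "\<not> q j divides x" if j: "j \<in> J" for j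
  proof
    assume "q j divides x"
    moreover have "q j divides ?r"
      using divides_trans[OF q_pow finprod_dvd[OF insert.hyps(1) pow j]] q j by blast
    ultimately have "q j divides b"
      unfolding xy(3) using q[of j] j r Q xy(1,2)
      by (intro divides_add divides_mult_right) auto
    then show False using insert.prems(4) j by blast
  qed
  then have "\<exists>d. (\<forall>j\<in>J. d j \<in> carrier R \<and> \<not> q j divides d j)
      \<and> (\<Otimes>\<^bsub>utm_ring R\<^esub>j\<in>J. utm R (q j [^] k j) (d j)) = utm R ?r x"
    using insert.prems(1,2) xy(1) by (intro insert.IH) simp_all
  then obtain d where d: "\<And>j. j \<in> J \<Longrightarrow> d j \<in> carrier R \<and> \<not> q j divides d j"
    and prod: "(\<Otimes>\<^bsub>utm_ring R\<^esub>j\<in>J. utm R (q j [^] k j) (d j)) = utm R ?r x"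
    by blast
  let ?d = "d(s := y)"
  have "(\<Otimes>\<^bsub>utm_ring R\<^esub>j\<in>insert s J. utm R (q j [^] k j) (?d j))
      = utm R ?Q y \<otimes>\<^bsub>utm_ring R\<^esub> (\<Otimes>\<^bsub>utm_ring R\<^esub>j\<in>J. utm R (q j [^] k j) (?d j))"
    using insert.hyps d q xy Q
    by (subst M.finprod_insert) (auto simp: utm_carrier_iff)
  also have "(\<Otimes>\<^bsub>utm_ring R\<^esub>j\<in>J. utm R (q j [^] k j) (?d j))
      = (\<Otimes>\<^bsub>utm_ring R\<^esub>j\<in>J. utm R (q j [^] k j) (d j))"
    using insert.hyps d q by (intro M.finprod_cong') (auto simp: utm_carrier_iff)
  also have "utm R ?Q y \<otimes>\<^bsub>utm_ring R\<^esub> \<dots> = utm R (?Q \<otimes> ?r) b"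
    unfolding prod using Q r xy by (simp add: utm_mult m_comm a_comm)
  also have "?Q \<otimes> ?r = (\<Otimes>j\<in>insert s J. q j [^] k j)"
    using insert.hyps pow Q by simp
  finally show ?case
    using d xy(2) not_dvd_y by (intro exI[of _ ?d]) auto
qed

section \<open>The factorization\<close>

theorem corollary6:
  fixes D :: "('a, 'b) ring_scheme"
    and \<alpha> :: "'a^2^2"
    and a b c a1 b1 u :: 'a
    and p q :: "nat \<Rightarrow> 'a"
    and e k :: "nat \<Rightarrow> nat"
    and n m :: nat
  assumes "principal_domain D"
    and "a \<in> carrier D" and "b \<in> carrier D"
    and "\<alpha> = utm D a b"
    and "\<alpha> \<noteq> \<zero>\<^bsub>utm_ring D\<^esub>" and "\<alpha> \<notin> Units (utm_ring D)"
    and "c \<in> carrier D" and "c gcdof\<^bsub>D\<^esub> a b"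
    and "a1 \<in> carrier D" and "a = c \<otimes>\<^bsub>D\<^esub> a1"
    and "b1 \<in> carrier D" and "b = c \<otimes>\<^bsub>D\<^esub> b1"
    and "u \<in> Units D"
    and "\<And>i. i \<in> {1..n} \<Longrightarrow> p i \<in> carrier D \<and> ring_prime\<^bsub>D\<^esub> (p i) \<and> 0 < e i"
    and "\<And>i j. \<lbrakk>i \<in> {1..n}; j \<in> {1..n}; i \<noteq> j\<rbrakk> \<Longrightarrow> \<not> associates D (p i) (p j)"
    and "c = u \<otimes>\<^bsub>D\<^esub> (\<Otimes>\<^bsub>D\<^esub>i\<in>{1..n}. p i [^]\<^bsub>D\<^esub> e i)"
    and "\<And>j. \<lbrakk>a \<noteq> \<zero>\<^bsub>D\<^esub>; j \<in> {1..m}\<rbrakk> \<Longrightarrow> q j \<in> carrier D \<and> ring_prime\<^bsub>D\<^esub> (q j) \<and> 0 < k j"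
    and "\<And>i j. \<lbrakk>a \<noteq> \<zero>\<^bsub>D\<^esub>; i \<in> {1..m}; j \<in> {1..m}; i \<noteq> j\<rbrakk> \<Longrightarrow> \<not> associates D (q i) (q j)"
    and "a \<noteq> \<zero>\<^bsub>D\<^esub> \<Longrightarrow> a1 = (\<Otimes>\<^bsub>D\<^esub>j\<in>{1..m}. q j [^]\<^bsub>D\<^esub> k j)"
  shows
    "(\<forall>i\<in>{1..n}. utm D (p i) \<zero>\<^bsub>D\<^esub> \<notin> Units (utm_ring D)
                \<and> irreducible_elt (utm_ring D) (utm D (p i) \<zero>\<^bsub>D\<^esub>))
   \<and> (a = \<zero>\<^bsub>D\<^esub> \<longrightarrow>
        b1 \<in> Units D
      \<and> utm D \<zero>\<^bsub>D\<^esub> (u \<otimes>\<^bsub>D\<^esub> b1) \<notin> Units (utm_ring D)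
      \<and> irreducible_elt (utm_ring D) (utm D \<zero>\<^bsub>D\<^esub> (u \<otimes>\<^bsub>D\<^esub> b1))
      \<and> \<alpha> = utm D \<zero>\<^bsub>D\<^esub> (u \<otimes>\<^bsub>D\<^esub> b1)
             \<otimes>\<^bsub>utm_ring D\<^esub> (\<Otimes>\<^bsub>utm_ring D\<^esub>i\<in>{1..n}. utm D (p i) \<zero>\<^bsub>D\<^esub> [^]\<^bsub>utm_ring D\<^esub> e i))
   \<and> (a \<noteq> \<zero>\<^bsub>D\<^esub> \<and> 1 \<le> m \<longrightarrow>
        utm D u \<zero>\<^bsub>D\<^esub> \<in> Units (utm_ring D)
      \<and> (\<exists>d :: nat \<Rightarrow> 'a.
            (\<forall>j\<in>{1..m}. d j \<in> carrier D \<and> \<one>\<^bsub>D\<^esub> gcdof\<^bsub>D\<^esub> (d j) (q j)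
                \<and> utm D (q j [^]\<^bsub>D\<^esub> k j) (d j) \<notin> Units (utm_ring D)
                \<and> irreducible_elt (utm_ring D) (utm D (q j [^]\<^bsub>D\<^esub> k j) (d j)))
          \<and> \<alpha> = utm D u \<zero>\<^bsub>D\<^esub>
             \<otimes>\<^bsub>utm_ring D\<^esub> (\<Otimes>\<^bsub>utm_ring D\<^esub>i\<in>{1..n}. utm D (p i) \<zero>\<^bsub>D\<^esub> [^]\<^bsub>utm_ring D\<^esub> e i)
             \<otimes>\<^bsub>utm_ring D\<^esub> (\<Otimes>\<^bsub>utm_ring D\<^esub>j\<in>{1..m}. utm D (q j [^]\<^bsub>D\<^esub> k j) (d j))))
   \<and> (a \<noteq> \<zero>\<^bsub>D\<^esub> \<and> m = 0 \<longrightarrow>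
        utm D u (u \<otimes>\<^bsub>D\<^esub> b1) \<in> Units (utm_ring D)
      \<and> \<alpha> = utm D u (u \<otimes>\<^bsub>D\<^esub> b1)
             \<otimes>\<^bsub>utm_ring D\<^esub> (\<Otimes>\<^bsub>utm_ring D\<^esub>i\<in>{1..n}. utm D (p i) \<zero>\<^bsub>D\<^esub> [^]\<^bsub>utm_ring D\<^esub> e i))"
proof -
  interpret principal_domain D by fact
  interpret M: cring "utm_ring D" by (rule utm_ring_cring)
  let ?P = "\<Otimes>\<^bsub>D\<^esub>i\<in>{1..n}. p i [^]\<^bsub>D\<^esub> e i"
  let ?MP = "\<Otimes>\<^bsub>utm_ring D\<^esub>i\<in>{1..n}. utm D (p i) \<zero>\<^bsub>D\<^esub> [^]\<^bsub>utm_ring D\<^esub> e i"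
  note a = assms(10) and b = assms(12) and c = assms(16)
  have p: "p i \<in> carrier D" "ring_prime\<^bsub>D\<^esub> (p i)" if "i \<in> {1..n}" for i
    using assms(14) that by blast+
  have P: "?P \<in> carrier D" and MP: "?MP = utm D ?P \<zero>\<^bsub>D\<^esub>"
    using p by (auto intro!: utm_diag_finprod_pow)
  have u: "u \<in> carrier D" by (rule Units_closed[OF assms(13)])
  note carr = assms(7,9,11) u P zero_closed
  have c_nonzero: "c \<noteq> \<zero>\<^bsub>D\<^esub>"
    using assms(4,5) a b carr by (auto simp: utm_zero)
  \<comment> \<open>cancelling \<open>c\<close> in the defining property of the greatest common divisor\<close>
  have coprime: "y \<in> Units D"
    if "y \<in> carrier D" "y divides\<^bsub>D\<^esub> a1" "y divides\<^bsub>D\<^esub> b1" for y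
  proof -
    have "c \<otimes>\<^bsub>D\<^esub> y divides\<^bsub>D\<^esub> a" "c \<otimes>\<^bsub>D\<^esub> y divides\<^bsub>D\<^esub> b"
      unfolding a b using that carr divides_mult by blast+
    then have "c \<otimes>\<^bsub>D\<^esub> y divides\<^bsub>D\<^esub> c \<otimes>\<^bsub>D\<^esub> \<one>\<^bsub>D\<^esub>"
      using assms(8) that(1) carr unfolding isgcd_def by simp
    then show ?thesis
      using mult_divides[of y "\<one>\<^bsub>D\<^esub>" c] that(1) carr c_nonzero divides_one by blast
  qed
  have part_p: "\<forall>i\<in>{1..n}. utm D (p i) \<zero>\<^bsub>D\<^esub> \<notin> Units (utm_ring D)
      \<and> irreducible_elt (utm_ring D) (utm D (p i) \<zero>\<^bsub>D\<^esub>)"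
    using p ring_prime_not_unit utm_prime_irreducible by (simp add: utm_Units_iff)
  have part_zero: "b1 \<in> Units D
      \<and> utm D \<zero>\<^bsub>D\<^esub> (u \<otimes>\<^bsub>D\<^esub> b1) \<notin> Units (utm_ring D)
      \<and> irreducible_elt (utm_ring D) (utm D \<zero>\<^bsub>D\<^esub> (u \<otimes>\<^bsub>D\<^esub> b1))
      \<and> \<alpha> = utm D \<zero>\<^bsub>D\<^esub> (u \<otimes>\<^bsub>D\<^esub> b1) \<otimes>\<^bsub>utm_ring D\<^esub> ?MP"
    if "a = \<zero>\<^bsub>D\<^esub>"
  proof -
    have "a1 = \<zero>\<^bsub>D\<^esub>" using that a carr c_nonzero integral by metis
    then have b1: "b1 \<in> Units D" using coprime[of b1] carr divides_zero by simp
    have "u \<otimes>\<^bsub>D\<^esub> b1 \<in> Units D" using b1 assms(13) by simp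
    moreover have "\<zero>\<^bsub>D\<^esub> \<notin> Units D" using zero_not_one unfolding Units_def by auto
    moreover have "\<alpha> = utm D \<zero>\<^bsub>D\<^esub> (u \<otimes>\<^bsub>D\<^esub> b1) \<otimes>\<^bsub>utm_ring D\<^esub> ?MP"
      unfolding assms(4) that b MP using carr by (simp add: utm_mult c m_ac)
    ultimately show ?thesis
      using b1 carr by (simp add: utm_Units_iff utm_nilpotent_irreducible)
  qed
  have part_nonzero: "utm D u \<zero>\<^bsub>D\<^esub> \<in> Units (utm_ring D)
      \<and> (\<exists>d :: nat \<Rightarrow> 'a.
            (\<forall>j\<in>{1..m}. d j \<in> carrier D \<and> \<one>\<^bsub>D\<^esub> gcdof\<^bsub>D\<^esub> (d j) (q j)
                \<and> utm D (q j [^]\<^bsub>D\<^esub> k j) (d j) \<notin> Units (utm_ring D)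
                \<and> irreducible_elt (utm_ring D) (utm D (q j [^]\<^bsub>D\<^esub> k j) (d j)))
          \<and> \<alpha> = utm D u \<zero>\<^bsub>D\<^esub> \<otimes>\<^bsub>utm_ring D\<^esub> ?MP
             \<otimes>\<^bsub>utm_ring D\<^esub> (\<Otimes>\<^bsub>utm_ring D\<^esub>j\<in>{1..m}. utm D (q j [^]\<^bsub>D\<^esub> k j) (d j)))"
    if "a \<noteq> \<zero>\<^bsub>D\<^esub>" "1 \<le> m"
  proof -
    let ?Q = "\<lambda>j. q j [^]\<^bsub>D\<^esub> k j"
    have q: "q j \<in> carrier D \<and> ring_prime\<^bsub>D\<^esub> (q j) \<and> 0 < k j" if "j \<in> {1..m}" for j
      using assms(17) \<open>a \<noteq> \<zero>\<^bsub>D\<^esub>\<close> that by blast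
    have a1: "a1 = finprod D ?Q {1..m}" using assms(19) that(1) by blast
    have q_dvd: "q j divides\<^bsub>D\<^esub> ?Q j" if "j \<in> {1..m}" for j
      using q[OF that] by (intro divides_pow) auto
    have "\<not> q j divides\<^bsub>D\<^esub> b1" if j: "j \<in> {1..m}" for j
    proof
      assume "q j divides\<^bsub>D\<^esub> b1"
      moreover have "?Q j divides\<^bsub>D\<^esub> a1"
        unfolding a1 using q j by (intro finprod_dvd) auto
      then have "q j divides\<^bsub>D\<^esub> a1" using divides_trans[OF q_dvd[OF j]] q[OF j] by blast
      ultimately show False using coprime[of "q j"] q[OF j] ring_prime_not_unit by blast
    qed
    moreover have "\<not> associates D (q i) (q j)" if "i \<in> {1..m}" "j \<in> {1..m}" "i \<noteq> j" for i j
      using assms(18) \<open>a \<noteq> \<zero>\<^bsub>D\<^esub>\<close> that by blast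
    ultimately have "\<exists>d. (\<forall>j\<in>{1..m}. d j \<in> carrier D \<and> \<not> q j divides\<^bsub>D\<^esub> d j)
        \<and> (\<Otimes>\<^bsub>utm_ring D\<^esub>j\<in>{1..m}. utm D (?Q j) (d j)) = utm D a1 b1"
      unfolding a1 using \<open>1 \<le> m\<close> q carr(3) by (intro prime_power_splitting) auto
    then obtain d where d: "\<And>j. j \<in> {1..m} \<Longrightarrow> d j \<in> carrier D \<and> \<not> q j divides\<^bsub>D\<^esub> d j"
      and prod: "(\<Otimes>\<^bsub>utm_ring D\<^esub>j\<in>{1..m}. utm D (?Q j) (d j)) = utm D a1 b1"
      by blast
    have "?Q j \<notin> Units D" if "j \<in> {1..m}" for j
      using divides_unit[OF q_dvd[OF that]] q[OF that] ring_prime_not_unit by blast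
    then have "\<forall>j\<in>{1..m}. d j \<in> carrier D \<and> \<one>\<^bsub>D\<^esub> gcdof\<^bsub>D\<^esub> (d j) (q j)
        \<and> utm D (?Q j) (d j) \<notin> Units (utm_ring D)
        \<and> irreducible_elt (utm_ring D) (utm D (?Q j) (d j))"
      using d q by (metis utm_Units_iff nat_pow_closed one_gcdof_prime utm_prime_power_irreducible)
    moreover have "\<alpha> = utm D u \<zero>\<^bsub>D\<^esub> \<otimes>\<^bsub>utm_ring D\<^esub> ?MP
        \<otimes>\<^bsub>utm_ring D\<^esub> (\<Otimes>\<^bsub>utm_ring D\<^esub>j\<in>{1..m}. utm D (?Q j) (d j))"
      unfolding assms(4) prod MP a b using carr by (simp add: utm_mult c)
    ultimately show ?thesis using assms(13) carr by (auto simp: utm_Units_iff)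
  qed
  have part_unit: "utm D u (u \<otimes>\<^bsub>D\<^esub> b1) \<in> Units (utm_ring D)
      \<and> \<alpha> = utm D u (u \<otimes>\<^bsub>D\<^esub> b1) \<otimes>\<^bsub>utm_ring D\<^esub> ?MP"
    if "a \<noteq> \<zero>\<^bsub>D\<^esub>" "m = 0"
  proof -
    have "a1 = \<one>\<^bsub>D\<^esub>" using assms(19) that by simp
    then show ?thesis
      unfolding assms(4) MP a b using carr assms(13)
      by (simp add: utm_Units_iff utm_mult c m_ac)
  qed
  show ?thesis using part_p part_zero part_nonzero part_unit by blast
qed

end
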